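(* Let $f\colon\mathbb{R}\to\mathbb{R}$ be a differentiable function, let $\lambda\neq 0$ be a real number, and let $T(x)=ax+b$ be an affine map of $\mathbb{R}$, with $a,b\in\mathbb{R}$ and $a\neq 0$. Then, for all $x\in\mathbb{R}$ with $f'(x)\neq 0$, $$\bigl(T\circ M_{\lambda,f\circ T}\circ T^{-1}\bigr)(x)=M_{\lambda,f}(x).$$
   Context: For a differentiable function $h\colon\mathbb{R}\to\mathbb{R}$ and a real damping parameter $\lambda$, set $N_{\lambda,h}(x)=x-\lambda\frac{h(x)}{h'(x)}$ and $M_{\lambda,h}(x)=N_{\lambda,h}(x)-\lambda\frac{h(N_{\lambda,h}(x))}{h'(x)}$; both are defined for all $x\in\mathbb{R}$ with $h'(x)\neq 0$. *)

theory Defs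
  imports "HOL-Analysis.Analysis"
begin

definition damped_newton :: "real \<Rightarrow> (real \<Rightarrow> real) \<Rightarrow> real \<Rightarrow> real"
  where "damped_newton lam h x = x - lam * (h x / deriv h x)"

(* The second step reuses the derivative at the initial point x.
   Both maps are meant only where the derivative of h is nonzero;
   elsewhere the values (with division by zero) carry no meaning. *)
definition damped_two_step :: "real \<Rightarrow> (real \<Rightarrow> real) \<Rightarrow> real \<Rightarrow> real"
  where "damped_two_step lam h x =
    damped_newton lam h x - lam * (h (damped_newton lam h x) / deriv h x)"

end

theory Submission
  imports Defs
begin

text \<open>Write g for the composite of f with T. By the chain rule g'(y) = a f'(T y), so each
  correction term of g at y carries a factor 1/a, which the slope of T cancels. Hence T conjugates
  the Newton step of g to that of f (\<open>damped_newton_comp_affine\<close>). This makes the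
  numerators of the second corrections agree, and the same cancellation carries over to two steps
  (\<open>damped_two_step_comp_affine\<close>). It remains to take y as the preimage of x.\<close>

lemma deriv_comp_affine:
  fixes f :: "real \<Rightarrow> real"
  assumes "f field_differentiable at (a * y + b)"
  shows "deriv (f \<circ> (\<lambda>x. a * x + b)) y = a * deriv f (a * y + b)"
proof -
  have inner: "((\<lambda>x. a * x + b) has_field_derivative a) (at y)"
    by (auto intro!: derivative_eq_intros)
  have outer: "(f has_field_derivative deriv f (a * y + b)) (at (a * y + b))"
    using assms by (simp add: field_differentiable_derivI)
  show ?thesis
    using DERIV_imp_deriv[OF DERIV_chain[OF outer inner]] by (simp only: mult.commute)
qed

text \<open>If f' vanishes at \<open>a * y + b\<close>, both quotients are 0 by the convention on
  division, and the two sides are still equal.\<close>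

lemma damped_newton_comp_affine:
  fixes f :: "real \<Rightarrow> real"
  assumes "f field_differentiable at (a * y + b)" and "a \<noteq> 0"
  shows "a * damped_newton lam (f \<circ> (\<lambda>x. a * x + b)) y + b = damped_newton lam f (a * y + b)"
  using assms(2) by (simp add: damped_newton_def deriv_comp_affine[OF assms(1)] right_diff_distrib)

lemma damped_two_step_comp_affine:
  fixes f :: "real \<Rightarrow> real"
  assumes "f field_differentiable at (a * y + b)" and "a \<noteq> 0"
  shows "a * damped_two_step lam (f \<circ> (\<lambda>x. a * x + b)) y + b = damped_two_step lam f (a * y + b)"
proof -
  let ?g = "f \<circ> (\<lambda>x. a * x + b)"
  note N = damped_newton_comp_affine[OF assms, of lam]
  \<comment> \<open>The inner T of \<open>?g\<close> turns the Newton point of \<open>?g\<close>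
    into that of f, by the conjugacy \<open>N\<close>.\<close>
  have "?g (damped_newton lam ?g y) = f (damped_newton lam f (a * y + b))"
    using N by simp
  then have "a * damped_two_step lam ?g y + b = a * damped_newton lam ?g y + b
      - lam * (f (damped_newton lam f (a * y + b)) / deriv f (a * y + b))"
    using assms(2) by (simp only: damped_two_step_def deriv_comp_affine[OF assms(1)]) (simp add: right_diff_distrib)
  then show ?thesis
    using N by (simp add: damped_two_step_def)
qed

theorem mainTheorem4:
  fixes f T :: "real \<Rightarrow> real" and lam a b :: real
  assumes "f differentiable_on UNIV"
    and "lam \<noteq> 0"
    and "a \<noteq> 0"
    and "T = (\<lambda>x. a * x + b)"
  shows "\<forall>x. deriv f x \<noteq> 0 \<longrightarrow>
    deriv (f \<circ> T) (inv T x) \<noteq> 0 \<and>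
    (T \<circ> damped_two_step lam (f \<circ> T) \<circ> inv T) x = damped_two_step lam f x"
proof (intro allI impI)
  fix x
  assume nz: "deriv f x \<noteq> 0"
  define y where "y = inv T x"
  \<comment> \<open>This places x in the range of T, which is what \<open>T (inv T x) = x\<close>
    requires.\<close>
  have "T ((x - b) / a) = x"
    using assms(3,4) by simp
  then have "T y = x"
    unfolding y_def by (intro f_inv_into_f range_eqI[OF sym])
  then have y: "a * y + b = x"
    using assms(4) by simp
  have diff: "f field_differentiable at (a * y + b)"
    using assms(1) by (simp add: differentiable_on_def field_differentiable_def real_differentiable_def)
  \<comment> \<open>The derivative in the first conjunct is a f'(x), a product of nonzero
    factors.\<close>
  show "deriv (f \<circ> T) (inv T x) \<noteq> 0 \<and>
    (T \<circ> damped_two_step lam (f \<circ> T) \<circ> inv T) x = damped_two_step lam f x"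
    using deriv_comp_affine[OF diff] damped_two_step_comp_affine[OF diff assms(3), of lam]
      nz assms(3,4) y by (simp add: y_def)
qed

end
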